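(* The problem $\mathrm{SRD}^\rho$ admits an online algorithm whose competitive ratio is $\dfrac{7\rho^2+8\rho\sqrt{\rho^2-1}-3}{3\rho^2+1}$ for every $\rho>\sqrt2$, and which is $\delta$-effective with $\delta=29/\sqrt{165}\approx 2.25765$.
   Context: Symmetric Rendezvous in a Disk, normalization $\mathrm{SRD}^\rho$ ($\rho>\sqrt2$): two robots start at two points of a circle of radius $\rho$ centred at a reference point $O$, at Euclidean distance $2$ from each other. Both robots know $O$, $\rho$ and their initial distance, but neither knows which of the two points of the circle at distance $2$ from it is its peer's position. Robots move in the plane with speed at most $1$, run the same synchronized randomized algorithm with independent random bits, and detect each other only when they occupy the same point at the same time (rendezvous). The optimal offline rendezvous time is $1$, so the competitive ratio of an algorithm on $\mathrm{SRD}^\rho$ is its expected rendezvous time. A family of algorithms (one for each $\rho$) is $\delta$-effective if $\delta$ is the largest value of $\rho$ for which its expected rendezvous time in $\mathrm{SRD}^\rho$ is at most $4.25$. *)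

theory Defs
  imports "HOL-Probability.Probability"
begin

text \<open>The plane is identified with the complex numbers. A trajectory maps times \<open>t \<ge> 0\<close> to
  positions; its values at negative times are irrelevant.\<close>

definition trajectory :: "complex \<Rightarrow> (real \<Rightarrow> complex) \<Rightarrow> bool" where
  "trajectory p f \<longleftrightarrow> f 0 = p \<and> 1-lipschitz_on {0..} f"

text \<open>Two trajectories that never meet have rendezvous time \<open>\<infinity>\<close>, the infimum of the empty set.\<close>

definition rendezvous_time :: "(real \<Rightarrow> complex) \<Rightarrow> (real \<Rightarrow> complex) \<Rightarrow> ennreal" where
  "rendezvous_time f g = (INF t\<in>{t. 0 \<le> t \<and> f t = g t}. ennreal t)"

definition offline_opt :: "complex \<Rightarrow> complex \<Rightarrow> ennreal" where
  "offline_opt p q = (INF (f, g)\<in>{(f, g). trajectory p f \<and> trajectory q g}. rendezvous_time f g)"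

definition coins :: "bool stream measure" where
  "coins = stream_space (measure_pmf (bernoulli_pmf (1/2)))"

text \<open>A robot learns nothing before the rendezvous, so its motion is a function of its own random
  bits and of time. It is described in the robot's private coordinates, where the reference point
  is \<open>0\<close> and the robot starts at \<open>\<rho>\<close> on the positive real axis. Because paths are continuous,
  measurability at each fixed time makes the rendezvous time of two robots measurable.\<close>

type_synonym algorithm = "bool stream \<Rightarrow> real \<Rightarrow> complex"

definition online_algorithm :: "real \<Rightarrow> algorithm \<Rightarrow> bool" where
  "online_algorithm \<rho> A \<longleftrightarrow>
     (\<forall>\<omega>. trajectory (of_real \<rho>) (A \<omega>)) \<and>
     (\<forall>t\<ge>0. (\<lambda>\<omega>. A \<omega> t) \<in> borel_measurable coins)"

text \<open>A frame translates private coordinates into positions in the plane. The robots share neither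
  a compass nor an orientation of the plane: each frame is an arbitrary isometry (a rotation or a
  reflection, up to translation) that takes \<open>0\<close> to the reference point \<open>c\<close> and \<open>\<rho>\<close> to the
  starting position \<open>p\<close> of the robot.\<close>

definition frame :: "real \<Rightarrow> complex \<Rightarrow> complex \<Rightarrow> (complex \<Rightarrow> complex) \<Rightarrow> bool" where
  "frame \<rho> c p \<phi> \<longleftrightarrow>
     (\<forall>x y. dist (\<phi> x) (\<phi> y) = dist x y) \<and> \<phi> 0 = c \<and> \<phi> (of_real \<rho>) = p"

definition SRD :: "real \<Rightarrow> (complex \<times> complex \<times> (complex \<Rightarrow> complex) \<times> (complex \<Rightarrow> complex)) set" where
  "SRD \<rho> = {(p, q, \<phi>, \<psi>). \<exists>c. dist p c = \<rho> \<and> dist q c = \<rho> \<and> dist p q = 2 \<and>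
              frame \<rho> c p \<phi> \<and> frame \<rho> c q \<psi>}"

text \<open>The product measure gives the two robots independent random bits.\<close>

definition expected_time :: "algorithm \<Rightarrow> (complex \<Rightarrow> complex) \<Rightarrow> (complex \<Rightarrow> complex) \<Rightarrow> ennreal" where
  "expected_time A \<phi> \<psi> =
     (\<integral>\<^sup>+ (\<omega>, \<omega>'). rendezvous_time (\<lambda>t. \<phi> (A \<omega> t)) (\<lambda>t. \<psi> (A \<omega>' t)) \<partial>(coins \<Otimes>\<^sub>M coins))"

definition expected_rendezvous_time :: "real \<Rightarrow> algorithm \<Rightarrow> ennreal" where
  "expected_rendezvous_time \<rho> A = (SUP (p, q, \<phi>, \<psi>)\<in>SRD \<rho>. expected_time A \<phi> \<psi>)"

definition competitive_ratio :: "real \<Rightarrow> algorithm \<Rightarrow> ennreal" where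
  "competitive_ratio \<rho> A = (SUP (p, q, \<phi>, \<psi>)\<in>SRD \<rho>. expected_time A \<phi> \<psi> / offline_opt p q)"

definition effective :: "real \<Rightarrow> (real \<Rightarrow> algorithm) \<Rightarrow> bool" where
  "effective \<delta> \<A> \<longleftrightarrow>
     (let S = {\<rho>. sqrt 2 < \<rho> \<and> expected_rendezvous_time \<rho> (\<A> \<rho>) \<le> ennreal 4.25}
      in \<delta> \<in> S \<and> (\<forall>\<rho>\<in>S. \<rho> \<le> \<delta>))"

end

theory Submission imports Defs begin

text \<open>Scale the circle to radius \<open>1\<close>, let \<open>2 a\<close> be the angle between the two robots, \<open>s = cos a\<close> and
  \<open>u = sin a = 1 / \<rho>\<close>. Each robot tosses a coin for one of the two candidate chords, walks to the
  midpoint of that chord (time \<open>u\<close>) and then straight to the midpoint of the other one (time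
  \<open>2 s u\<close>). If both coins point to the true chord, the robots meet after the first leg; if neither
  does, they meet at the end of the second leg. In the two remaining cases they end the phase on
  the circle of radius \<open>s\<close>, again at angle \<open>2 a\<close>, so that they can repeat the phase scaled
  by \<open>s\<close>. The expected time thus satisfies \<open>E = u / 4 + 3 (u + 2 s u) / 4 + s E / 2\<close>, and
  \<open>\<rho> E = (2 + 3 s) / (2 - s)\<close>. The phases shrink geometrically, so every trajectory reaches the
  centre in bounded time, which makes \<open>E\<close> finite.\<close>

section \<open>Rendezvous times: a single meeting, and affine changes of time\<close>

lemma rendezvous_time_unique:
  assumes "0 \<le> t" "\<And>t'. 0 \<le> t' \<Longrightarrow> t' \<le> t \<Longrightarrow> f t' = g t' \<longleftrightarrow> t' = t"
  shows "rendezvous_time f g = ennreal t"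
  unfolding rendezvous_time_def
proof (rule antisym)
  show "(INF t\<in>{t. 0 \<le> t \<and> f t = g t}. ennreal t) \<le> ennreal t"
    using assms by (intro INF_lower) auto
  show "ennreal t \<le> (INF t\<in>{t. 0 \<le> t \<and> f t = g t}. ennreal t)"
  proof (rule INF_greatest)
    fix t' assume "t' \<in> {t. 0 \<le> t \<and> f t = g t}"
    then show "ennreal t \<le> ennreal t'"
      using assms(2)[of t'] by (intro ennreal_leI) force
  qed
qed

text \<open>The meeting times of \<open>f\<close> and \<open>g\<close> are the images of those of
  \<open>f'\<close> and \<open>g'\<close> under the increasing continuous map
  \<open>a + b * t\<close>, which commutes with infima. This serves to restart a phase
  (\<open>a = phase_time\<close>, \<open>b = s\<close>) and to rescale the circle
  (\<open>a = 0\<close>, \<open>b = \<rho>\<close>).\<close>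

lemma rendezvous_time_affine:
  assumes "0 \<le> a" "0 < b"
    and before: "\<And>t. 0 \<le> t \<Longrightarrow> t < a \<Longrightarrow> f t \<noteq> g t"
    and after: "\<And>t. 0 \<le> t \<Longrightarrow> f (a + b * t) = g (a + b * t) \<longleftrightarrow> f' t = g' t"
  shows "rendezvous_time f g = ennreal a + ennreal b * rendezvous_time f' g'"
proof -
  define S where "S = {t. 0 \<le> t \<and> f' t = g' t}"
  have "{t. 0 \<le> t \<and> f t = g t} = (\<lambda>t. a + b * t) ` S"
  proof (intro equalityI subsetI)
    fix t assume t: "t \<in> {t. 0 \<le> t \<and> f t = g t}"
    then have "a \<le> t" using before[of t] by force
    have eq: "t = a + b * ((t - a) / b)" using \<open>0 < b\<close> by simp
    have "(t - a) / b \<in> S"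
      unfolding S_def using t \<open>a \<le> t\<close> \<open>0 < b\<close> after[of "(t - a) / b"] by simp
    then show "t \<in> (\<lambda>t. a + b * t) ` S" using eq by blast
  next
    fix t assume "t \<in> (\<lambda>t. a + b * t) ` S"
    then show "t \<in> {t. 0 \<le> t \<and> f t = g t}" using assms by (auto simp: S_def)
  qed
  then have 1: "rendezvous_time f g = (INF t\<in>S. ennreal a + ennreal b * ennreal t)"
    using assms(1,2) unfolding rendezvous_time_def
    by (auto simp: image_image S_def ennreal_plus ennreal_mult intro!: INF_cong)
  show ?thesis
  \<comment> \<open>Without a meeting both sides are infinite; the continuity argument needs a
    nonempty set.\<close>
  proof (cases "S = {}")
    case True
    then show ?thesis
      using 1 \<open>0 < b\<close> by (auto simp: rendezvous_time_def S_def[symmetric] ennreal_mult_top)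
  next
    case False
    have "(\<lambda>x. ennreal a + ennreal b * x) (INF t\<in>S. ennreal t) =
        (INF x\<in>ennreal ` S. ennreal a + ennreal b * x)"
    proof (rule continuous_at_Inf_mono)
      show "mono (\<lambda>x. ennreal a + ennreal b * x)"
        by (intro monoI add_left_mono mult_left_mono) auto
      have "continuous_on UNIV (\<lambda>x. ennreal a + ennreal b * x)"
        by (intro continuous_on_add continuous_on_const ennreal_continuous_on_cmult)
          (auto intro: continuous_on_id)
      then show "continuous (at_right (INF t\<in>S. ennreal t)) (\<lambda>x. ennreal a + ennreal b * x)"
        by (meson UNIV_I continuous_on_eq_continuous_within continuous_within_subset subset_UNIV)
    qed (use False in auto)
    then show ?thesis
      using 1 by (simp add: rendezvous_time_def S_def[symmetric] image_image)
  qed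
qed

section \<open>Measurability of the rendezvous time\<close>

lemma rational_dense_in_initial_interval:
  fixes t r d :: real
  assumes "r \<in> \<rat>" "0 \<le> t" "t \<le> r" "0 < d"
  obtains q where "q \<in> \<rat>" "0 \<le> q" "q \<le> r" "\<bar>q - t\<bar> < d"
\<comment> \<open>No point of the interval lies above \<open>t = r\<close>; there the rational
  \<open>r\<close> itself serves.\<close>
proof (cases "t = r")
  case False
  then obtain q where "q \<in> \<rat>" "t < q" "q < min r (t + d)"
    using Rats_dense_in_real[of t "min r (t + d)"] assms by force
  then show ?thesis using that[of q] assms by auto
qed (use that[of r] assms in auto)

lemma meeting_iff_rational_approach:
  fixes f g :: "real \<Rightarrow> 'a :: metric_space"
  assumes cont: "continuous_on {0..} f" "continuous_on {0..} g" and r: "r \<in> \<rat>" "0 \<le> r"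
  shows "(\<exists>t\<in>{0..r}. f t = g t) \<longleftrightarrow> (\<forall>n. \<exists>q\<in>\<rat> \<inter> {0..r}. dist (f q) (g q) < 1 / real (Suc n))"
    (is "?L \<longleftrightarrow> ?R")
proof
  have c: "continuous_on {0..r} (\<lambda>t. dist (f t) (g t))"
    by (intro continuous_on_dist continuous_on_subset[OF cont(1)] continuous_on_subset[OF cont(2)]) auto
  {
    assume ?L
    then obtain t where t: "t \<in> {0..r}" "f t = g t" by blast
    show ?R
    proof
      fix n
      have "0 < 1 / real (Suc n)" by simp
      with c t(1) obtain d where d: "0 < d"
        "\<forall>q\<in>{0..r}. dist q t < d \<longrightarrow> dist (dist (f q) (g q)) (dist (f t) (g t)) < 1 / real (Suc n)"
        unfolding continuous_on_iff by blast
      obtain q where "q \<in> \<rat>" "0 \<le> q" "q \<le> r" "\<bar>q - t\<bar> < d"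
        using rational_dense_in_initial_interval[of r t d] r t(1) d(1) by auto
      then show "\<exists>q\<in>\<rat> \<inter> {0..r}. dist (f q) (g q) < 1 / real (Suc n)"
        using d(2)[rule_format, of q] t(2) by (intro bexI[of _ q]) (simp_all add: dist_real_def)
    qed
  next
    assume R: ?R
    obtain t where t: "t \<in> {0..r}" "\<And>y. y \<in> {0..r} \<Longrightarrow> dist (f t) (g t) \<le> dist (f y) (g y)"
      using continuous_attains_inf[OF _ _ c] r by auto
    have "dist (f t) (g t) = 0"
    proof (rule ccontr)
      assume "dist (f t) (g t) \<noteq> 0"
      then have "0 < dist (f t) (g t)" by simp
      \<comment> \<open>A positive minimum would exceed some \<open>1 / real (Suc n)\<close>, which
        the approximations undercut.\<close>
      then obtain n where n: "1 / real (Suc n) < dist (f t) (g t)"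
        by (rule nat_approx_posE)
      obtain q where "q \<in> {0..r}" "dist (f q) (g q) < 1 / real (Suc n)"
        using R by blast
      then show False using t(2)[of q] n by simp
    qed
    then show ?L using t(1) by auto
  }
qed

text \<open>The event that the time is below \<open>y\<close> is a union, over the countably many
  rationals \<open>r\<close> in \<open>Q\<close>, of the events of a meeting up to time
  \<open>r\<close>; the rational criterion makes each of them measurable.\<close>

lemma borel_measurable_rendezvous_time:
  fixes f g :: "'a \<Rightarrow> real \<Rightarrow> complex"
  assumes "\<And>x. continuous_on {0..} (f x)" "\<And>x. continuous_on {0..} (g x)"
    and "\<And>t. 0 \<le> t \<Longrightarrow> (\<lambda>x. f x t) \<in> borel_measurable M"
      "\<And>t. 0 \<le> t \<Longrightarrow> (\<lambda>x. g x t) \<in> borel_measurable M"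
  shows "(\<lambda>x. rendezvous_time (f x) (g x)) \<in> borel_measurable M"
proof (rule borel_measurableI_less)
  fix y :: ennreal
  define Q where "Q = {r. r \<in> \<rat> \<and> 0 \<le> r \<and> ennreal r < y}"
  have "countable Q"
    unfolding Q_def by (rule countable_subset[OF _ countable_rat]) auto
  have less: "rendezvous_time (f x) (g x) < y \<longleftrightarrow> (\<exists>r\<in>Q. \<exists>t\<in>{0..r}. f x t = g x t)" for x
  proof
    assume "rendezvous_time (f x) (g x) < y"
    then obtain t where t: "0 \<le> t" "f x t = g x t" "ennreal t < y"
      by (auto simp: rendezvous_time_def INF_less_iff)
    obtain r where "r \<in> \<rat>" "t \<le> r" "ennreal r < y"
    proof (cases y)
      case (real y')
      then have "t < y'" using t by (simp add: ennreal_less_iff)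
      then obtain r where r: "r \<in> \<rat>" "t < r" "r < y'" using Rats_dense_in_real by blast
      then have "ennreal r < y"
        using real t(1) by (simp add: ennreal_less_iff)
      then show ?thesis using r that[of r] by simp
    next
      case top
      then show ?thesis using that[of "real (nat \<lceil>t\<rceil>)"] real_nat_ceiling_ge[of t] by simp
    qed
    then show "\<exists>r\<in>Q. \<exists>t\<in>{0..r}. f x t = g x t"
      using t(1,2) unfolding Q_def by (intro bexI[of _ r] bexI[of _ t]) simp_all
  next
    assume "\<exists>r\<in>Q. \<exists>t\<in>{0..r}. f x t = g x t"
    then obtain r t where "r \<in> Q" "0 \<le> t" "t \<le> r" "f x t = g x t" by auto
    then have "rendezvous_time (f x) (g x) \<le> ennreal t" "ennreal t \<le> ennreal r" "ennreal r < y"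
      unfolding Q_def rendezvous_time_def by (auto intro: INF_lower ennreal_leI)
    then show "rendezvous_time (f x) (g x) < y" by simp
  qed
  have meet: "(\<exists>t\<in>{0..r}. f x t = g x t) \<longleftrightarrow>
      (\<forall>n. \<exists>q\<in>\<rat> \<inter> {0..r}. dist (f x q) (g x q) < 1 / real (Suc n))" if "r \<in> Q" for r x
    using that unfolding Q_def by (intro meeting_iff_rational_approach assms(1,2)) auto
  have "{x \<in> space M. rendezvous_time (f x) (g x) < y} =
    {x \<in> space M. \<exists>r\<in>Q. \<forall>n. \<exists>q\<in>\<rat> \<inter> {0..r}. dist (f x q) (g x q) < 1 / real (Suc n)}"
    unfolding less using meet by (simp cong: bex_cong del: of_nat_Suc)
  also have "\<dots> \<in> sets M"
  proof -
    have "countable (\<rat> \<inter> {0..r})" for r :: real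
      by (intro countable_Int1 countable_rat)
    moreover have "{x \<in> space M. dist (f x q) (g x q) < 1 / real (Suc n)} \<in> sets M"
      if "0 \<le> q" for q n
      using assms(3,4)[OF that] by measurable
    ultimately show ?thesis
      using \<open>countable Q\<close>
      by (intro sets.sets_Collect_countable_Ex' sets.sets_Collect_countable_All) auto
  qed
  finally show "{x \<in> space M. rendezvous_time (f x) (g x) < y} \<in> sets M" .
qed

section \<open>Coin streams: conditioning on the first tosses\<close>

lemma prob_space_coins: "prob_space coins"
  unfolding coins_def by (rule prob_space.prob_space_stream_space[OF prob_space_measure_pmf])

lemma space_coins [simp]: "space coins = UNIV"
  by (simp add: coins_def space_stream_space)

lemma shd_coins [measurable]: "shd \<in> measurable coins (count_space UNIV)"
  unfolding coins_def using measurable_shd[of "measure_pmf (bernoulli_pmf (1/2))"] by simp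

lemma stl_coins [measurable]: "stl \<in> measurable coins coins"
  unfolding coins_def using measurable_stl by simp

lemma SCons_coins [measurable]: "(##) b \<in> measurable coins coins"
  unfolding coins_def by measurable

lemma nn_integral_coins:
  assumes "f \<in> borel_measurable coins"
  shows "(\<integral>\<^sup>+\<omega>. f \<omega> \<partial>coins) =
    ((\<integral>\<^sup>+\<omega>. f (True ## \<omega>) \<partial>coins) + (\<integral>\<^sup>+\<omega>. f (False ## \<omega>) \<partial>coins)) * ennreal (1/2)"
proof -
  have "(\<integral>\<^sup>+\<omega>. f \<omega> \<partial>coins) =
      (\<integral>\<^sup>+b. (\<integral>\<^sup>+\<omega>. f (b ## \<omega>) \<partial>coins) \<partial>measure_pmf (bernoulli_pmf (1/2)))"
    using assms unfolding coins_def
    by (rule prob_space.nn_integral_stream_space[OF prob_space_measure_pmf])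
  then show ?thesis
    by (subst (asm) nn_integral_bernoulli_pmf) (simp_all add: distrib_right)
qed

text \<open>Fubini and one use of \<open>nn_integral_coins\<close> per robot leave four equally
  likely pairs of first tosses. This is the source of the recursion for the expected time.\<close>

lemma nn_integral_coins_pair:
  assumes [measurable]: "F \<in> borel_measurable (coins \<Otimes>\<^sub>M coins)"
  shows "(\<integral>\<^sup>+p. F p \<partial>(coins \<Otimes>\<^sub>M coins)) =
    ((\<integral>\<^sup>+(\<omega>, \<omega>'). F (True ## \<omega>, True ## \<omega>') \<partial>(coins \<Otimes>\<^sub>M coins)) +
     (\<integral>\<^sup>+(\<omega>, \<omega>'). F (True ## \<omega>, False ## \<omega>') \<partial>(coins \<Otimes>\<^sub>M coins)) +
     (\<integral>\<^sup>+(\<omega>, \<omega>'). F (False ## \<omega>, True ## \<omega>') \<partial>(coins \<Otimes>\<^sub>M coins)) +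
     (\<integral>\<^sup>+(\<omega>, \<omega>'). F (False ## \<omega>, False ## \<omega>') \<partial>(coins \<Otimes>\<^sub>M coins))) * ennreal (1/4)"
proof -
  interpret prob_space coins by (rule prob_space_coins)
  have fst: "(\<integral>\<^sup>+p. G p \<partial>(coins \<Otimes>\<^sub>M coins)) = (\<integral>\<^sup>+\<omega>. \<integral>\<^sup>+\<omega>'. G (\<omega>, \<omega>') \<partial>coins \<partial>coins)"
    if "G \<in> borel_measurable (coins \<Otimes>\<^sub>M coins)" for G :: "_ \<Rightarrow> ennreal"
    using nn_integral_fst[OF that] by simp
  have quarter: "ennreal (1/2) * ennreal (1/2) = ennreal (1/4)"
    by (simp del: ennreal_half add: ennreal_mult[symmetric])
  have inner: "(\<integral>\<^sup>+\<omega>'. F (\<omega>, \<omega>') \<partial>coins) =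
      ((\<integral>\<^sup>+\<omega>'. F (\<omega>, True ## \<omega>') \<partial>coins) + (\<integral>\<^sup>+\<omega>'. F (\<omega>, False ## \<omega>') \<partial>coins)) * ennreal (1/2)" for \<omega>
    by (rule nn_integral_coins) measurable
  have step: "(\<integral>\<^sup>+\<omega>. \<integral>\<^sup>+\<omega>'. F (b ## \<omega>, \<omega>') \<partial>coins \<partial>coins) =
      ((\<integral>\<^sup>+(\<omega>, \<omega>'). F (b ## \<omega>, True ## \<omega>') \<partial>(coins \<Otimes>\<^sub>M coins)) +
       (\<integral>\<^sup>+(\<omega>, \<omega>'). F (b ## \<omega>, False ## \<omega>') \<partial>(coins \<Otimes>\<^sub>M coins))) * ennreal (1/2)" for b
    unfolding inner
    by (simp add: nn_integral_multc nn_integral_add fst case_prod_beta)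
  have "(\<integral>\<^sup>+p. F p \<partial>(coins \<Otimes>\<^sub>M coins)) =
      ((\<integral>\<^sup>+\<omega>. \<integral>\<^sup>+\<omega>'. F (True ## \<omega>, \<omega>') \<partial>coins \<partial>coins) +
       (\<integral>\<^sup>+\<omega>. \<integral>\<^sup>+\<omega>'. F (False ## \<omega>, \<omega>') \<partial>coins \<partial>coins)) * ennreal (1/2)"
    by (subst fst, simp) (rule nn_integral_coins, measurable)
  then show ?thesis
    unfolding step
    by (simp add: distrib_right[symmetric] mult.assoc quarter add.assoc del: ennreal_half)
qed

section \<open>Frames as rotations and reflections\<close>

definition mirror :: "bool \<Rightarrow> complex \<Rightarrow> complex" where
  "mirror \<sigma> z = (if \<sigma> then cnj z else z)"

lemma mirror_simps [simp]:
  "mirror \<sigma> 0 = 0" "mirror \<sigma> (of_real r) = of_real r" "mirror \<sigma> (x * y) = mirror \<sigma> x * mirror \<sigma> y"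
  "mirror \<sigma> (x + y) = mirror \<sigma> x + mirror \<sigma> y" "mirror \<sigma> (x - y) = mirror \<sigma> x - mirror \<sigma> y"
  "mirror \<sigma> (cnj x) = cnj (mirror \<sigma> x)" "mirror \<sigma> 1 = 1"
  by (auto simp: mirror_def)

lemma norm_mirror [simp]: "norm (mirror \<sigma> z) = norm z"
  by (auto simp: mirror_def)

text \<open>The distances to \<open>0\<close> and \<open>r\<close> determine a point up to
  conjugation, and the image of \<open>\<i>\<close> then decides between identity and
  conjugation.\<close>

lemma isometry_fixing_axis:
  fixes g :: "complex \<Rightarrow> complex"
  assumes iso: "\<And>x y. dist (g x) (g y) = dist x y" and "g 0 = 0" "g (of_real r) = of_real r" "0 < r"
  obtains \<sigma> where "g = mirror \<sigma>"
proof -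
  have pm: "g z = z \<or> g z = cnj z" for z
  proof -
    have "(norm (g z))\<^sup>2 = (norm z)\<^sup>2" "(norm (g z - of_real r))\<^sup>2 = (norm (z - of_real r))\<^sup>2"
      using iso[of z 0] iso[of z "of_real r"] assms(2,3) by (simp_all add: dist_norm)
    then have 1: "(Re (g z))\<^sup>2 + (Im (g z))\<^sup>2 = (Re z)\<^sup>2 + (Im z)\<^sup>2"
      and 2: "(Re (g z) - r)\<^sup>2 + (Im (g z))\<^sup>2 = (Re z - r)\<^sup>2 + (Im z)\<^sup>2"
      by (simp_all add: cmod_power2)
    have "r * (Re (g z) - Re z) = 0"
      using 1 2 unfolding power2_eq_square by argo
    then have "Re (g z) = Re z" using \<open>0 < r\<close> by simp
    moreover from this 1 have "Im (g z) = Im z \<or> Im (g z) = - Im z"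
      by (simp add: power2_eq_iff)
    ultimately show ?thesis by (auto simp: complex_eq_iff)
  qed
  \<comment> \<open>So far the choice between \<open>z\<close> and \<open>cnj z\<close> may vary
    with \<open>z\<close>; comparing distances to \<open>\<i>\<close> makes it uniform.\<close>
  have norms: "(norm (g z - g \<i>))\<^sup>2 = (norm (z - \<i>))\<^sup>2" for z
    using iso[of z \<i>] by (simp add: dist_norm)
  consider "g \<i> = \<i>" | "g \<i> = - \<i>" using pm[of \<i>] by auto
  then show ?thesis
  proof cases
    case 1
    have "g z = mirror False z" for z
      using pm[of z] norms[of z, unfolded cmod_power2] 1
      by (auto simp: mirror_def complex_eq_iff power2_eq_square algebra_simps)
    then show ?thesis using that by blast
  next
    case 2
    have "g z = mirror True z" for z
      using pm[of z] norms[of z, unfolded cmod_power2] 2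
      by (auto simp: mirror_def complex_eq_iff power2_eq_square algebra_simps)
    then show ?thesis using that by blast
  qed
qed

text \<open>Undoing the translation by \<open>c\<close> and the rotation by the unit vector from
  \<open>c\<close> to \<open>p\<close> leaves an isometry that fixes \<open>0\<close> and
  \<open>\<rho>\<close>.\<close>

lemma frame_cases:
  assumes "frame \<rho> c p \<phi>" "0 < \<rho>"
  obtains \<sigma> where "\<And>z. \<phi> z = c + (p - c) / of_real \<rho> * mirror \<sigma> z" "norm ((p - c) / of_real \<rho>) = 1"
proof -
  define e where "e = (p - c) / of_real \<rho>"
  have iso: "dist (\<phi> x) (\<phi> y) = dist x y" and "\<phi> 0 = c" "\<phi> (of_real \<rho>) = p" for x y
    using assms(1) by (auto simp: frame_def)
  then have "norm (p - c) = \<rho>" 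
    using iso[of "of_real \<rho>" 0] \<open>0 < \<rho>\<close> by (simp add: dist_norm)
  then have e: "norm e = 1"
    using \<open>0 < \<rho>\<close> by (simp add: e_def norm_divide)
  then have "e \<noteq> 0" by auto
  obtain \<sigma> where \<sigma>: "(\<lambda>z. (\<phi> z - c) / e) = mirror \<sigma>"
  proof (rule isometry_fixing_axis)
    show "dist ((\<phi> x - c) / e) ((\<phi> y - c) / e) = dist x y" for x y
      using iso[of x y] e by (simp add: dist_norm diff_divide_distrib[symmetric] norm_divide)
    show "(\<phi> (of_real \<rho>) - c) / e = of_real \<rho>"
      using \<open>\<phi> (of_real \<rho>) = p\<close> \<open>e \<noteq> 0\<close> \<open>0 < \<rho>\<close> by (auto simp: e_def)
  qed (use \<open>\<phi> 0 = c\<close> \<open>0 < \<rho>\<close> in auto)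
  have "\<phi> z = c + e * mirror \<sigma> z" for z
    using fun_cong[OF \<sigma>, of z] \<open>e \<noteq> 0\<close> by (simp add: field_simps)
  then show ?thesis using that e unfolding e_def by blast
qed

section \<open>The offline optimum\<close>

text \<open>Walking straight to the midpoint attains \<open>1\<close>. Conversely, robots that meet
  at time \<open>t\<close> have each moved at most \<open>t\<close>, and together they must bridge
  the distance \<open>2\<close>.\<close>

lemma offline_opt_eq:
  assumes "dist p q = 2"
  shows "offline_opt p q = 1"
proof (rule antisym)
  have lip: "1-lipschitz_on {0..} (\<lambda>t. a + of_real t * ((b - a) / 2))" if "dist a b = 2" for a b :: complex
  proof (rule lipschitz_onI)
    fix x y :: real
    have "(a + of_real x * ((b - a) / 2)) - (a + of_real y * ((b - a) / 2)) = of_real (x - y) * ((b - a) / 2)"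
      by (simp add: algebra_simps diff_divide_distrib)
    moreover have "norm ((b - a) / 2) = 1"
      using that by (simp add: norm_divide dist_norm norm_minus_commute)
    ultimately show "dist (a + of_real x * ((b - a) / 2)) (a + of_real y * ((b - a) / 2)) \<le> 1 * dist x y"
      unfolding dist_norm by (simp only: norm_mult norm_of_real real_norm_def)
  qed simp
  define f where "f = (\<lambda>t. p + of_real t * ((q - p) / 2))"
  define g where "g = (\<lambda>t. q + of_real t * ((p - q) / 2))"
  have "trajectory p f" "trajectory q g"
    using lip[of p q] lip[of q p] assms by (simp_all add: trajectory_def f_def g_def dist_commute)
  then have "offline_opt p q \<le> rendezvous_time f g"
    unfolding offline_opt_def by (intro INF_lower2[of "(f, g)"]) auto
  also have "\<dots> \<le> ennreal 1"
    unfolding rendezvous_time_def by (rule INF_lower) (simp add: f_def g_def field_simps)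
  finally show "offline_opt p q \<le> 1" by simp
  have "1 \<le> rendezvous_time f g" if f: "trajectory p f" and g: "trajectory q g" for f g
    unfolding rendezvous_time_def
  proof (rule INF_greatest)
    fix t assume t: "t \<in> {t. 0 \<le> t \<and> f t = g t}"
    have "dist p (f t) \<le> t" "dist q (g t) \<le> t"
      using lipschitz_onD[of 1 "{0..}" f 0 t] lipschitz_onD[of 1 "{0..}" g 0 t] f g t
      by (simp_all add: trajectory_def dist_real_def)
    then have "2 \<le> 2 * t"
      using dist_triangle2[of p q "f t"] assms t by simp
    then show "1 \<le> ennreal t" by (simp add: ennreal_ge_1)
  qed
  then show "1 \<le> offline_opt p q"
    unfolding offline_opt_def by (intro INF_greatest) auto
qed

section \<open>Unit-speed paths: concatenation, segments and limits\<close>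

lemma lipschitz_on_concat_atLeast:
  fixes a b :: real
  assumes "C-lipschitz_on {a..b} f" "C-lipschitz_on {b..} g" "f b = g b"
  shows "C-lipschitz_on {a..} (\<lambda>x. if x \<le> b then f x else g x)"
proof (rule lipschitz_onI)
  fix x y assume "x \<in> {a..}" "y \<in> {a..}"
  \<comment> \<open>Two given points lie in a bounded interval, where concatenation of Lipschitz
    maps applies.\<close>
  then have "x \<in> {a..max x y}" "y \<in> {a..max x y}" by auto
  moreover have "C-lipschitz_on {a..max x y} (\<lambda>x. if x \<le> b then f x else g x)"
    using assms by (intro lipschitz_on_concat lipschitz_on_subset[OF assms(2)]) auto
  ultimately show "dist (if x \<le> b then f x else g x) (if y \<le> b then f y else g y) \<le> C * dist x y"
    by (intro lipschitz_onD)
qed (use assms(1) lipschitz_on_nonneg in blast)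

lemma lipschitz_on_unit_speed:
  fixes p z :: complex
  assumes "norm z = d" "0 < d"
  shows "1-lipschitz_on X (\<lambda>t. p + of_real ((t - a) / d) * z)"
proof (rule lipschitz_onI)
  fix x y :: real
  have "(p + of_real ((x - a) / d) * z) - (p + of_real ((y - a) / d) * z) = of_real ((x - y) / d) * z"
    by (simp add: algebra_simps diff_divide_distrib)
  then have "dist (p + of_real ((x - a) / d) * z) (p + of_real ((y - a) / d) * z) = \<bar>(x - y) / d\<bar> * d"
    using assms(1) unfolding dist_norm by (simp only: norm_mult norm_of_real)
  also have "\<dots> = dist x y"
    using assms(2) by (simp add: abs_divide dist_real_def)
  finally show "dist (p + of_real ((x - a) / d) * z) (p + of_real ((y - a) / d) * z) \<le> 1 * dist x y"
    by simp
qed simp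

lemma lipschitz_on_tendsto:
  fixes F :: "nat \<Rightarrow> real \<Rightarrow> complex"
  assumes "\<And>k. 1-lipschitz_on X (F k)" "\<And>t. t \<in> X \<Longrightarrow> (\<lambda>k. F k t) \<longlonglongrightarrow> f t"
  shows "1-lipschitz_on X f"
proof (rule lipschitz_onI)
  fix x y assume xy: "x \<in> X" "y \<in> X"
  show "dist (f x) (f y) \<le> 1 * dist x y"
  proof (rule LIMSEQ_le_const2)
    show "(\<lambda>k. dist (F k x) (F k y)) \<longlonglongrightarrow> dist (f x) (f y)"
      using assms(2) xy by (intro tendsto_dist) auto
    show "\<exists>N. \<forall>n\<ge>N. dist (F n x) (F n y) \<le> 1 * dist x y"
      using lipschitz_onD[OF assms(1) xy] by blast
  qed
qed simp

lemma dist_mult_left: "dist (c * x) (c * y) = norm c * dist x y" for c x y :: complex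
  by (simp add: dist_norm norm_mult flip: right_diff_distrib)

section \<open>The algorithm on the unit circle, as a limit of finitely many phases\<close>

locale half_angle =
  fixes s u :: real
  assumes s_pos: "0 < s" and u_pos: "0 < u" and pythagoras: "s\<^sup>2 + u\<^sup>2 = 1"
begin

lemma s_less_1: "s < 1"
proof -
  have "s\<^sup>2 < 1\<^sup>2" unfolding one_power2 using pythagoras zero_less_power[OF u_pos, of 2] by linarith
  then show ?thesis using power_less_imp_less_base by fastforce
qed

definition phase_time :: real where "phase_time = u + 2 * s * u"

text \<open>With the robot at \<open>1\<close>, the candidate positions of its peer are the squares
  of the two headings, so the chord midpoints are \<open>s * heading b\<close>.\<close>

definition heading :: "bool \<Rightarrow> complex" where
  "heading b = Complex s (if b then u else - u)"

definition leg :: "complex \<Rightarrow> real \<Rightarrow> complex" where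
  "leg w t = (if t \<le> u then 1 + of_real (t / u) * (of_real s * w - 1)
    else of_real s * w + of_real ((t - u) / (2 * s * u)) * (of_real s * (cnj w - w)))"

text \<open>Multiplication by the end point of a phase takes the start \<open>1\<close> of a fresh
  run to that point and shrinks the circle by \<open>s\<close>; dividing the time by
  \<open>s\<close> keeps the speed. In the base case \<open>max\<close> makes the robot stop at the
  centre.\<close>

primrec approx :: "nat \<Rightarrow> bool stream \<Rightarrow> real \<Rightarrow> complex" where
  "approx 0 \<omega> t = of_real (max 0 (1 - t))"
| "approx (Suc k) \<omega> t = (if t \<le> phase_time then leg (heading (shd \<omega>)) t
    else of_real s * cnj (heading (shd \<omega>)) * approx k (stl \<omega>) ((t - phase_time) / s))"

text \<open>The algorithm is the limit of the algorithms that perform \<open>k\<close> phases and then walk straight to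
  the centre.\<close>

definition run :: "bool stream \<Rightarrow> real \<Rightarrow> complex" where
  "run \<omega> t = lim (\<lambda>k. approx k \<omega> t)"

text \<open>The quotient is the sum of the durations \<open>phase_time * s ^ j\<close> of all
  phases; the maximum with \<open>1\<close> leaves time for the straight walk of
  \<open>approx 0\<close>.\<close>

definition horizon :: real where "horizon = max 1 (phase_time / (1 - s))"

lemma u_less_phase_time: "u < phase_time" and phase_time_pos: "0 < phase_time"
  using s_pos u_pos by (auto simp: phase_time_def add_pos_pos)

lemma horizon: "1 \<le> horizon" "phase_time + s * horizon \<le> horizon"
proof -
  have "phase_time / (1 - s) \<le> horizon" by (simp add: horizon_def)
  then show "phase_time + s * horizon \<le> horizon"
    using s_less_1 by (simp add: divide_le_eq algebra_simps)
qed (simp add: horizon_def)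

lemma norm_heading: "norm (heading b) = 1"
  using pythagoras by (auto simp: heading_def cmod_def)

lemma leg_0: "leg w 0 = 1"
  using u_pos by (simp add: leg_def)

lemma leg_u: "leg w u = of_real s * w"
  using u_pos by (simp add: leg_def)

lemma leg_phase_time: "leg w phase_time = of_real s * cnj w"
proof -
  have "(phase_time - u) / (2 * s * u) = 1" using s_pos u_pos by (simp add: phase_time_def)
  then show ?thesis using u_less_phase_time by (simp add: leg_def right_diff_distrib del: of_real_divide of_real_diff)
qed

lemma mirror_leg: "mirror \<sigma> (leg w t) = leg (mirror \<sigma> w) t"
  by (simp add: leg_def del: of_real_divide of_real_diff)

text \<open>The two segments have lengths \<open>u\<close> and \<open>2 * s * u\<close>, exactly the
  times allotted to them.\<close>

lemma leg_lipschitz: "1-lipschitz_on {0..phase_time} (leg (heading b))"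
proof -
  let ?w = "heading b"
  have "of_real s * ?w - 1 = Complex (- (u * u)) (s * (if b then u else - u))"
    using pythagoras by (simp add: heading_def complex_eq_iff power2_eq_square)
  then have "(norm (of_real s * ?w - 1))\<^sup>2 = u\<^sup>2 * (s\<^sup>2 + u\<^sup>2)"
    by (simp add: cmod_power2) (simp add: power2_eq_square algebra_simps)
  then have 1: "norm (of_real s * ?w - 1) = u"
    using pythagoras u_pos by (simp add: power2_eq_iff_nonneg)
  have "cnj ?w - ?w = Complex 0 (if b then - 2 * u else 2 * u)"
    by (simp add: heading_def complex_eq_iff)
  then have "norm (cnj ?w - ?w) = 2 * u"
    using u_pos by (simp add: cmod_def)
  then have 2: "norm (of_real s * (cnj ?w - ?w)) = 2 * s * u"
    using s_pos by (simp add: norm_mult)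
  have "1-lipschitz_on {0..phase_time} (\<lambda>t. if t \<le> u then 1 + of_real ((t - 0) / u) * (of_real s * ?w - 1)
    else of_real s * ?w + of_real ((t - u) / (2 * s * u)) * (of_real s * (cnj ?w - ?w)))"
    by (intro lipschitz_on_concat lipschitz_on_unit_speed 1 2) (use s_pos u_pos in simp_all)
  then show ?thesis
    unfolding leg_def diff_zero .
qed

lemma approx_at_0: "approx k \<omega> 0 = 1"
  using phase_time_pos by (cases k) (simp_all add: leg_0)

text \<open>Each level of the recursion scales space and time by the same factor \<open>s\<close>,
  so the speed bound survives; the pieces agree at \<open>phase_time\<close>.\<close>

lemma approx_lipschitz: "1-lipschitz_on {0..} (approx k \<omega>)"
proof (induction k arbitrary: \<omega>)
  case 0
  show ?case
  proof (rule lipschitz_onI)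
    fix x y :: real
    have "\<bar>max 0 (1 - x) - max 0 (1 - y)\<bar> \<le> \<bar>x - y\<bar>" by linarith
    then show "dist (approx 0 \<omega> x) (approx 0 \<omega> y) \<le> 1 * dist x y"
      by (simp only: approx.simps dist_of_real dist_real_def mult_1)
  qed simp
next
  case (Suc k)
  have "1-lipschitz_on {phase_time..} (\<lambda>t. of_real s * cnj (heading (shd \<omega>)) * approx k (stl \<omega>) ((t - phase_time) / s))"
  proof (rule lipschitz_onI)
    fix x y assume "x \<in> {phase_time..}" "y \<in> {phase_time..}"
    then have "dist (approx k (stl \<omega>) ((x - phase_time) / s)) (approx k (stl \<omega>) ((y - phase_time) / s)) \<le> 1 * dist ((x - phase_time) / s) ((y - phase_time) / s)"
      using s_pos by (intro lipschitz_onD[OF Suc.IH]) auto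
    also have "\<dots> = dist x y / s"
      using s_pos by (simp add: dist_real_def diff_divide_distrib[symmetric] abs_divide)
    finally show "dist (of_real s * cnj (heading (shd \<omega>)) * approx k (stl \<omega>) ((x - phase_time) / s))
        (of_real s * cnj (heading (shd \<omega>)) * approx k (stl \<omega>) ((y - phase_time) / s)) \<le> 1 * dist x y"
      using s_pos norm_heading by (simp add: dist_mult_left norm_mult le_divide_eq mult.commute)
  qed simp
  then have "1-lipschitz_on {0..} (\<lambda>t. if t \<le> phase_time then leg (heading (shd \<omega>)) t
    else of_real s * cnj (heading (shd \<omega>)) * approx k (stl \<omega>) ((t - phase_time) / s))"
    by (intro lipschitz_on_concat_atLeast leg_lipschitz) (simp_all add: leg_phase_time approx_at_0)
  then show ?case by simp
qed

lemma approx_horizon: "horizon \<le> t \<Longrightarrow> approx k \<omega> t = 0"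
proof (induction k arbitrary: \<omega> t)
  case 0
  then show ?case using horizon by simp
next
  case (Suc k)
  have "0 < s * horizon" using s_pos horizon(1) by simp
  then have "phase_time < t" using horizon(2) Suc.prems by linarith
  moreover have "horizon \<le> (t - phase_time) / s"
    using horizon(2) Suc.prems s_pos by (simp add: field_simps)
  ultimately show ?case using Suc.IH by simp
qed

lemma norm_approx_le:
  assumes "0 \<le> t"
  shows "norm (approx k \<omega> t) \<le> horizon"
proof (cases "t \<le> horizon")
  case True
  then have "dist (approx k \<omega> t) (approx k \<omega> horizon) \<le> 1 * dist t horizon"
    using assms by (intro lipschitz_onD[OF approx_lipschitz]) auto
  then show ?thesis using True assms by (simp add: approx_horizon dist_real_def)
qed (use horizon approx_horizon[of t] in auto)

text \<open>Both paths share their first \<open>k\<close> phases, and each phase shrinks the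
  remaining difference by \<open>s\<close>. The factor \<open>2 * horizon\<close> bounds the
  difference of any two approximations.\<close>

lemma approx_diff:
  assumes "0 \<le> t"
  shows "norm (approx (k + j) \<omega> t - approx k \<omega> t) \<le> 2 * horizon * s ^ k"
  using assms
proof (induction k arbitrary: \<omega> t)
  case 0
  then show ?case
    using norm_triangle_ineq4[of "approx j \<omega> t" "approx 0 \<omega> t"]
      norm_approx_le[of t j \<omega>] norm_approx_le[of t 0 \<omega>]
    by (simp del: approx.simps)
next
  case (Suc k)
  show ?case
  proof (cases "t \<le> phase_time")
    case True
    then show ?thesis using horizon s_pos by simp
  next
    case False
    have "norm (approx (k + j) (stl \<omega>) ((t - phase_time) / s) - approx k (stl \<omega>) ((t - phase_time) / s)) \<le> 2 * horizon * s ^ k"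
      using False s_pos by (intro Suc.IH) simp
    from mult_left_mono[OF this, of s] show ?thesis
      using False s_pos norm_heading
      by (simp add: right_diff_distrib[symmetric] norm_mult mult.left_commute del: mult_le_cancel_left_pos)
  qed
qed

lemma approx_tendsto:
  assumes "0 \<le> t"
  shows "(\<lambda>k. approx k \<omega> t) \<longlonglongrightarrow> run \<omega> t"
proof -
  have "Cauchy (\<lambda>k. approx k \<omega> t)"
  proof (rule metric_CauchyI)
    fix e :: real assume "0 < e"
    have "(\<lambda>k. 2 * horizon * s ^ k) \<longlonglongrightarrow> 2 * horizon * 0"
      using s_pos s_less_1 by (intro tendsto_mult_left LIMSEQ_realpow_zero) auto
    then have "\<forall>\<^sub>F k in sequentially. 2 * horizon * s ^ k < e"
      using \<open>0 < e\<close> by (auto dest: order_tendstoD(2))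
    then obtain M where M: "\<And>k. M \<le> k \<Longrightarrow> 2 * horizon * s ^ k < e"
      by (auto simp: eventually_sequentially)
    have "dist (approx m \<omega> t) (approx (m + j) \<omega> t) < e" if "M \<le> m" for m j
      using approx_diff[OF assms, of m j \<omega>] M[OF that] by (simp add: dist_norm norm_minus_commute)
    then show "\<exists>M. \<forall>m\<ge>M. \<forall>n\<ge>M. dist (approx m \<omega> t) (approx n \<omega> t) < e"
      by (metis dist_commute le_Suc_ex nat_le_linear)
  qed
  then show ?thesis
    unfolding run_def by (simp add: Cauchy_convergent_iff convergent_LIMSEQ_iff)
qed

lemma run_lipschitz: "1-lipschitz_on {0..} (run \<omega>)"
  by (rule lipschitz_on_tendsto[where F = "\<lambda>k. approx k \<omega>", OF approx_lipschitz]) (simp add: approx_tendsto)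

lemma run_at_0: "run \<omega> 0 = 1"
  using approx_tendsto[of 0 \<omega>] by (simp add: approx_at_0 LIMSEQ_const_iff)

lemma run_horizon: "run \<omega> horizon = 0"
  using approx_tendsto[of horizon \<omega>] horizon(1) by (simp add: approx_horizon LIMSEQ_const_iff)

lemma run_leg:
  assumes "0 \<le> t" "t \<le> phase_time"
  shows "run \<omega> t = leg (heading (shd \<omega>)) t"
  \<comment> \<open>The sequence is shifted by one because \<open>approx 0\<close> performs no
    phase.\<close>
  using LIMSEQ_Suc[OF approx_tendsto[OF assms(1)], of \<omega>] assms(2) by (simp add: LIMSEQ_const_iff)

text \<open>Self-similarity of the limit: after its first phase a run is a scaled and rotated fresh
  run on the remaining tosses.\<close>

lemma run_shift:
  assumes "0 \<le> t"
  shows "run \<omega> (phase_time + s * t) = of_real s * cnj (heading (shd \<omega>)) * run (stl \<omega>) t"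
\<comment> \<open>At \<open>t = 0\<close> the recursion is still in its first branch, so the end
  point of the leg is compared with the start of the fresh run.\<close>
proof (cases "t = 0")
  case True
  then show ?thesis using phase_time_pos by (simp add: run_leg leg_phase_time run_at_0)
next
  case False
  then have "0 < s * t" using assms s_pos by simp
  then have "(\<lambda>k. approx (Suc k) \<omega> (phase_time + s * t)) =
      (\<lambda>k. of_real s * cnj (heading (shd \<omega>)) * approx k (stl \<omega>) t)"
    using s_pos by auto
  moreover have "(\<lambda>k. approx (Suc k) \<omega> (phase_time + s * t)) \<longlonglongrightarrow> run \<omega> (phase_time + s * t)"
    using \<open>0 < s * t\<close> phase_time_pos by (intro LIMSEQ_Suc approx_tendsto) simp
  moreover have "(\<lambda>k. of_real s * cnj (heading (shd \<omega>)) * approx k (stl \<omega>) t) \<longlonglongrightarrow>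
      of_real s * cnj (heading (shd \<omega>)) * run (stl \<omega>) t"
    by (intro tendsto_mult_left approx_tendsto assms)
  ultimately show ?thesis using LIMSEQ_unique by metis
qed

lemma approx_measurable: "(\<lambda>\<omega>. approx k \<omega> t) \<in> borel_measurable coins"
proof (induction k arbitrary: t)
  case (Suc k)
  have [measurable]: "(\<lambda>\<omega>. approx k (stl \<omega>) t) \<in> borel_measurable coins" for t
    using measurable_compose[OF stl_coins Suc.IH] .
  have [measurable]: "(\<lambda>\<omega>. h (shd \<omega>)) \<in> borel_measurable coins" for h :: "bool \<Rightarrow> complex"
    using measurable_compose[OF shd_coins] by simp
  show ?case by simp measurable
qed simp

lemma run_measurable:
  assumes "0 \<le> t"
  shows "(\<lambda>\<omega>. run \<omega> t) \<in> borel_measurable coins"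
  by (rule borel_measurable_LIMSEQ_metric[where f = "\<lambda>k \<omega>. approx k \<omega> t", OF approx_measurable]) (simp add: approx_tendsto assms)

section \<open>Meetings within one phase\<close>

lemma second_leg_fraction_le_1: "t \<le> phase_time \<Longrightarrow> (t - u) / (2 * s * u) \<le> 1"
  using s_pos u_pos by (simp add: phase_time_def field_simps)

text \<open>Coordinates are rotated so that the midpoint of the true chord is the real number \<open>s\<close>, and the
  robots start at \<open>cnj v\<close> and \<open>v\<close>. During a phase they stay on opposite sides of the real axis and
  each touches it once, at \<open>s\<close>.\<close>

lemma Im_leg_toward:
  assumes v: "v = Complex s y" "y\<^sup>2 = u\<^sup>2" and t: "0 \<le> t" "t \<le> phase_time"
  obtains a where "0 \<le> a" "Im (cnj v * leg v t) = - y * a" "a = 0 \<longleftrightarrow> t = u"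
proof (cases "t \<le> u")
  case True
  have "Im (cnj v * leg v t) = - y * (1 - t / u)"
    using True by (simp add: leg_def v(1) algebra_simps)
  then show ?thesis
    by (rule that[rotated]) (use True u_pos in \<open>auto simp: field_simps\<close>)
next
  case False
  let ?r = "(t - u) / (2 * s * u)"
  have "Im (cnj v * leg v t) = - y * (2 * s\<^sup>2 * ?r)"
    using False by (simp add: leg_def v(1) power2_eq_square algebra_simps del: times_divide_eq_right)
  then show ?thesis using that[of "2 * s\<^sup>2 * ?r"] False u_pos s_pos by simp
qed

lemma Im_leg_away:
  assumes v: "v = Complex s y" "y\<^sup>2 = u\<^sup>2" and t: "0 \<le> t" "t \<le> phase_time"
  obtains a where "0 \<le> a" "Im (cnj v * leg (cnj v) t) = - y * a" "a = 0 \<longleftrightarrow> t = phase_time"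
proof (cases "t \<le> u")
  case True
  have "Im (cnj v * leg (cnj v) t) = - y * ((1 - t / u) + 2 * s\<^sup>2 * (t / u))"
    using True by (simp add: leg_def v(1) power2_eq_square algebra_simps del: times_divide_eq_right)
  \<comment> \<open>A convex combination of the positive numbers \<open>1\<close> and
    \<open>2 * s\<^sup>2\<close>: on the way to the wrong midpoint the axis is not reached.\<close>
  moreover have "0 < (1 - t / u) + 2 * s\<^sup>2 * (t / u)"
  proof (cases "t = 0")
    case False
    then show ?thesis using True t(1) u_pos s_pos by (intro add_nonneg_pos) simp_all
  qed simp
  ultimately show ?thesis
    using that[of "(1 - t / u) + 2 * s\<^sup>2 * (t / u)"] True u_less_phase_time by force
next
  case False
  let ?r = "(t - u) / (2 * s * u)"
  have "Im (cnj v * leg (cnj v) t) = - y * (2 * s\<^sup>2 * (1 - ?r))"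
    using False by (simp add: leg_def v(1) power2_eq_square algebra_simps del: times_divide_eq_right)
  moreover have "1 - ?r = 0 \<longleftrightarrow> t = phase_time"
    using s_pos u_pos by (auto simp: phase_time_def field_simps)
  ultimately show ?thesis using that[of "2 * s\<^sup>2 * (1 - ?r)"] second_leg_fraction_le_1[OF t(2)] s_pos by simp
qed

lemma unit_square: "v = Complex s y \<Longrightarrow> y\<^sup>2 = u\<^sup>2 \<Longrightarrow> cnj v * v = 1"
  using pythagoras by (simp add: complex_eq_iff power2_eq_square)

text \<open>The two orientation flags are separate because the robots need not agree on an
  orientation.\<close>

definition meeting_time :: "complex \<Rightarrow> bool \<Rightarrow> bool \<Rightarrow> bool stream \<times> bool stream \<Rightarrow> ennreal" where
  "meeting_time v \<sigma> \<sigma>' = (\<lambda>(\<omega>, \<omega>').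
    rendezvous_time (\<lambda>t. cnj v * mirror \<sigma> (run \<omega> t)) (\<lambda>t. v * mirror \<sigma>' (run \<omega>' t)))"

text \<open>Robots on opposite sides of the axis can only meet on it. A robot is there at
  \<open>u\<close> if it heads for the true chord first and at \<open>phase_time\<close> otherwise,
  so a meeting requires equal choices. The true chord lies along \<open>v\<close> for the first
  robot and along \<open>cnj v\<close> for the second.\<close>

lemma meet_during_leg:
  fixes w w' :: complex
  assumes v: "v = Complex s y" "y\<^sup>2 = u\<^sup>2" and t: "0 \<le> t" "t \<le> phase_time"
    and w: "w = v \<or> w = cnj v" "w' = v \<or> w' = cnj v"
  shows "cnj v * leg w t = v * leg w' t \<longleftrightarrow>
    w = v \<and> w' = cnj v \<and> t = u \<or> w \<noteq> v \<and> w' \<noteq> cnj v \<and> t = phase_time"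
proof -
  have "y \<noteq> 0" using v(2) u_pos by auto
  then have ne: "cnj v \<noteq> v" using v(1) by (simp add: complex_eq_iff)
  have side: "\<exists>a\<ge>0. Im (cnj v * leg x t) = - y * a \<and> (a = 0 \<longleftrightarrow> t = (if x = v then u else phase_time))"
    if "x = v \<or> x = cnj v" for x
  proof (cases "x = v")
    case True
    then show ?thesis using Im_leg_toward[OF v t] by metis
  next
    case False
    then show ?thesis using Im_leg_away[OF v t] that by metis
  qed
  have pos: "cnj v * leg v u = s" "cnj v * leg (cnj v) phase_time = s" "v * leg (cnj v) u = s" "v * leg v phase_time = s"
    using unit_square[OF v] by (simp_all add: leg_u leg_phase_time mult.left_commute mult.commute[of v])
  obtain a where a: "0 \<le> a" "Im (cnj v * leg w t) = - y * a" "a = 0 \<longleftrightarrow> t = (if w = v then u else phase_time)"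
    using side[OF w(1)] by blast
  obtain a' where a': "0 \<le> a'" "Im (cnj v * leg (cnj w') t) = - y * a'"
      "a' = 0 \<longleftrightarrow> t = (if cnj w' = v then u else phase_time)"
    using side[of "cnj w'"] w(2) by auto
  \<comment> \<open>Reflection in the axis turns the second robot into a first one, so
    \<open>side\<close> covers both.\<close>
  have "v * leg w' t = cnj (cnj v * leg (cnj w') t)"
    using mirror_leg[of True "cnj w'" t] by (simp add: mirror_def)
  then have "Im (v * leg w' t) = y * a'" using a'(2) by (metis minus_mult_left minus_minus cnj.sel(2))
  then have *: "a = 0 \<and> a' = 0" if "cnj v * leg w t = v * leg w' t"
  proof -
    have "y * (a + a') = 0"
      using that a(2) \<open>Im (v * leg w' t) = y * a'\<close> by (simp add: algebra_simps)
    then show ?thesis using \<open>y \<noteq> 0\<close> a(1) a'(1) by simp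
  qed
  show ?thesis
  proof
    assume "cnj v * leg w t = v * leg w' t"
    from *[OF this] show "w = v \<and> w' = cnj v \<and> t = u \<or> w \<noteq> v \<and> w' \<noteq> cnj v \<and> t = phase_time"
      using a(3) a'(3) u_less_phase_time by (auto split: if_splits)
  next
    assume "w = v \<and> w' = cnj v \<and> t = u \<or> w \<noteq> v \<and> w' \<noteq> cnj v \<and> t = phase_time"
    then show "cnj v * leg w t = v * leg w' t"
      using w pos by auto
  qed
qed

text \<open>If exactly one robot heads for the true chord, the private directions agree,
  \<open>w = w'\<close>. Both continuations then carry the common factor \<open>s * cnj w\<close>,
  and cancelling it restores the initial configuration.\<close>

lemma meeting_time_step:
  assumes v: "v = Complex s y" "y\<^sup>2 = u\<^sup>2"
    and w: "w = mirror \<sigma> (heading b)" "w' = mirror \<sigma>' (heading b')"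
    and ww: "w = v \<or> w = cnj v" "w' = v \<or> w' = cnj v"
  shows "meeting_time v \<sigma> \<sigma>' (b ## \<omega>, b' ## \<omega>') =
    (if w = v \<and> w' = cnj v then ennreal u
     else if w \<noteq> v \<and> w' \<noteq> cnj v then ennreal phase_time
     else ennreal phase_time + ennreal s * meeting_time v \<sigma> \<sigma>' (\<omega>, \<omega>'))"
proof -
  let ?f = "\<lambda>t. cnj v * mirror \<sigma> (run (b ## \<omega>) t)" and ?g = "\<lambda>t. v * mirror \<sigma>' (run (b' ## \<omega>') t)"
  have meet: "?f t = ?g t \<longleftrightarrow> w = v \<and> w' = cnj v \<and> t = u \<or> w \<noteq> v \<and> w' \<noteq> cnj v \<and> t = phase_time"
    if "0 \<le> t" "t \<le> phase_time" for t
    using meet_during_leg[OF v that ww] that by (simp add: run_leg mirror_leg w)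
  consider "w = v \<and> w' = cnj v" | "w \<noteq> v \<and> w' \<noteq> cnj v"
    | "w = v \<and> w' \<noteq> cnj v" | "w \<noteq> v \<and> w' = cnj v" by blast
  then show ?thesis
  proof cases
    case 1
    have "rendezvous_time ?f ?g = ennreal u"
      by (rule rendezvous_time_unique) (use 1 meet u_pos u_less_phase_time in auto)
    then show ?thesis using 1 by (simp add: meeting_time_def)
  next
    case 2
    have "rendezvous_time ?f ?g = ennreal phase_time"
      by (rule rendezvous_time_unique) (use 2 meet phase_time_pos in auto)
    then show ?thesis using 2 by (simp add: meeting_time_def)
  next
    case 3
    then have "w' = v" using ww by simp
    have "v \<noteq> 0" using v(1) s_pos by (auto simp: complex_eq_iff)
    have "rendezvous_time ?f ?g = ennreal phase_time + ennreal s * meeting_time v \<sigma> \<sigma>' (\<omega>, \<omega>')"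
      unfolding meeting_time_def prod.case
    proof (rule rendezvous_time_affine)
      fix t :: real assume "0 \<le> t"
      have "?f (phase_time + s * t) = (of_real s * cnj v) * (cnj v * mirror \<sigma> (run \<omega> t))"
        "?g (phase_time + s * t) = (of_real s * cnj v) * (v * mirror \<sigma>' (run \<omega>' t))"
        using \<open>0 \<le> t\<close> 3 \<open>w' = v\<close> w by (simp_all add: run_shift mult_ac)
      then show "?f (phase_time + s * t) = ?g (phase_time + s * t) \<longleftrightarrow>
          cnj v * mirror \<sigma> (run \<omega> t) = v * mirror \<sigma>' (run \<omega>' t)"
        using \<open>v \<noteq> 0\<close> s_pos by (simp only: mult_cancel_left) simp
    qed (use meet 3 phase_time_pos s_pos in auto)
    then show ?thesis using 3 by (simp add: meeting_time_def)
  next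
    case 4
    then have "w = cnj v" using ww by simp
    have "v \<noteq> 0" using v(1) s_pos by (auto simp: complex_eq_iff)
    have "rendezvous_time ?f ?g = ennreal phase_time + ennreal s * meeting_time v \<sigma> \<sigma>' (\<omega>, \<omega>')"
      unfolding meeting_time_def prod.case
    proof (rule rendezvous_time_affine)
      fix t :: real assume "0 \<le> t"
      have "?f (phase_time + s * t) = (of_real s * v) * (cnj v * mirror \<sigma> (run \<omega> t))"
        "?g (phase_time + s * t) = (of_real s * v) * (v * mirror \<sigma>' (run \<omega>' t))"
        using \<open>0 \<le> t\<close> 4 \<open>w = cnj v\<close> w
        by (simp_all add: run_shift mult_ac)
      then show "?f (phase_time + s * t) = ?g (phase_time + s * t) \<longleftrightarrow>
          cnj v * mirror \<sigma> (run \<omega> t) = v * mirror \<sigma>' (run \<omega>' t)"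
        using \<open>v \<noteq> 0\<close> s_pos by (simp only: mult_cancel_left) simp
    qed (use meet 4 phase_time_pos s_pos in auto)
    then show ?thesis using 4 by (simp add: meeting_time_def)
  qed
qed

text \<open>\<open>d\<close> is the toss that heads along \<open>v\<close>. It depends on
  \<open>\<sigma>\<close> and on the sign of \<open>y\<close>, which is harmless for a fair
  coin.\<close>

lemma heading_cases:
  assumes v: "v = Complex s y" "y\<^sup>2 = u\<^sup>2"
  obtains d where "\<And>b. mirror \<sigma> (heading b) = (if b = d then v else cnj v)"
proof -
  consider "y = u" | "y = - u" using v(2) by (auto simp: power2_eq_iff)
  then show ?thesis
  proof cases
    case 1
    then show ?thesis
      by (intro that[of "\<not> \<sigma>"]) (auto simp: v(1) heading_def mirror_def complex_eq_iff)
  next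
    case 2
    then show ?thesis
      by (intro that[of \<sigma>]) (auto simp: v(1) heading_def mirror_def complex_eq_iff)
  qed
qed

section \<open>The expected meeting time on the unit circle\<close>

lemma meeting_time_measurable:
  "meeting_time v \<sigma> \<sigma>' \<in> borel_measurable (coins \<Otimes>\<^sub>M coins)"
proof -
  have cont: "continuous_on {0..} (\<lambda>t. x * mirror \<tau> (run \<omega> t))" for x \<tau> \<omega>
    using lipschitz_on_continuous_on[OF run_lipschitz, of \<omega>]
    unfolding mirror_def by (cases \<tau>) (auto intro!: continuous_intros)
  have meas: "(\<lambda>\<omega>. x * mirror \<tau> (run \<omega> t)) \<in> borel_measurable coins" if "0 \<le> t" for x \<tau> t
    using run_measurable[OF that] unfolding mirror_def
    by (cases \<tau>) (auto intro!: borel_measurable_times borel_measurable_continuous_on[OF continuous_on_cnj])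
  show ?thesis
    unfolding meeting_time_def case_prod_beta
  proof (rule borel_measurable_rendezvous_time)
    fix t :: real assume "0 \<le> t"
    show "(\<lambda>p. cnj v * mirror \<sigma> (run (fst p) t)) \<in> borel_measurable (coins \<Otimes>\<^sub>M coins)"
      using measurable_compose[OF measurable_fst meas[OF \<open>0 \<le> t\<close>]] .
    show "(\<lambda>p. v * mirror \<sigma>' (run (snd p) t)) \<in> borel_measurable (coins \<Otimes>\<^sub>M coins)"
      using measurable_compose[OF measurable_snd meas[OF \<open>0 \<le> t\<close>]] .
  qed (rule cont)+
qed

lemma expected_meeting_time:
  assumes v: "v = Complex s y" "y\<^sup>2 = u\<^sup>2"
  shows "(\<integral>\<^sup>+p. meeting_time v \<sigma> \<sigma>' p \<partial>(coins \<Otimes>\<^sub>M coins)) = ennreal (u * (2 + 3 * s) / (2 - s))"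
proof -
  interpret C: prob_space coins by (rule prob_space_coins)
  interpret CC: pair_prob_space coins coins ..
  let ?N = "coins \<Otimes>\<^sub>M coins" and ?E = "\<integral>\<^sup>+p. meeting_time v \<sigma> \<sigma>' p \<partial>(coins \<Otimes>\<^sub>M coins)"
  note [measurable] = meeting_time_measurable
  \<comment> \<open>All runs are at the centre at time \<open>horizon\<close>. Finiteness has to be
    known beforehand, since an infinite expectation would satisfy the recursion too.\<close>
  have "meeting_time v \<sigma> \<sigma>' p \<le> ennreal horizon" for p
    unfolding meeting_time_def rendezvous_time_def case_prod_beta
    by (rule INF_lower) (use horizon(1) in \<open>simp add: run_horizon\<close>)
  then have "?E \<le> (\<integral>\<^sup>+p. ennreal horizon \<partial>?N)"
    by (intro nn_integral_mono)
  also have "\<dots> = ennreal horizon"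
    by (simp add: CC.emeasure_space_1)
  finally obtain e where e: "?E = ennreal e" "0 \<le> e"
    by (metis ennreal_cases ennreal_less_top leD top.not_eq_extremum)
  obtain d where d: "\<And>b. mirror \<sigma> (heading b) = (if b = d then v else cnj v)"
    using heading_cases[OF v] by blast
  \<comment> \<open>For the second robot the true chord lies along \<open>cnj v\<close>, hence the
    exchanged roles.\<close>
  obtain d' where d': "\<And>b. mirror \<sigma>' (heading b) = (if b = d' then cnj v else v)"
    using heading_cases[of "cnj v" "- y" \<sigma>'] v by (metis complex_cnj complex_cnj_cnj power2_minus)
  have "y \<noteq> 0" using v(2) u_pos by auto
  then have ne: "cnj v \<noteq> v" "v \<noteq> cnj v" using v(1) by (simp_all add: complex_eq_iff)
  have step: "meeting_time v \<sigma> \<sigma>' (b ## \<omega>, b' ## \<omega>') =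
      (if b = d \<and> b' = d' then ennreal u else if b \<noteq> d \<and> b' \<noteq> d' then ennreal phase_time
       else ennreal phase_time + ennreal s * meeting_time v \<sigma> \<sigma>' (\<omega>, \<omega>'))" for b b' \<omega> \<omega>'
    by (subst meeting_time_step[OF v refl refl]) (auto simp: d d' ne)
  have miss: "(\<integral>\<^sup>+(\<omega>, \<omega>'). (ennreal phase_time + ennreal s * meeting_time v \<sigma> \<sigma>' (\<omega>, \<omega>')) \<partial>?N) = ennreal (phase_time + s * e)"
    using e phase_time_pos s_pos unfolding case_prod_beta prod.collapse
    by (simp add: nn_integral_add nn_integral_cmult CC.emeasure_space_1 ennreal_mult ennreal_plus)
  have const: "(\<integral>\<^sup>+(\<omega>, \<omega>'). c \<partial>?N) = c" for c :: ennreal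
    unfolding case_prod_beta by (simp add: CC.emeasure_space_1)
  \<comment> \<open>Whatever \<open>d\<close> and \<open>d'\<close> are, one pair of tosses meets at
    \<open>u\<close>, one at \<open>phase_time\<close>, and two repeat the phase.\<close>
  have "ennreal e = (ennreal u + ennreal phase_time + ennreal (phase_time + s * e) + ennreal (phase_time + s * e)) * ennreal (1 / 4)"
    unfolding e(1)[symmetric] nn_integral_coins_pair[OF meeting_time_measurable] step
    by (cases d; cases d') (simp_all add: miss const add_ac del: ennreal_plus)
  also have "\<dots> = ennreal ((u + phase_time + (phase_time + s * e) + (phase_time + s * e)) * (1 / 4))"
    using u_pos phase_time_pos s_pos e(2) by (simp add: ennreal_plus[symmetric] ennreal_mult[symmetric] del: ennreal_plus)
  finally have "e = (u + phase_time + (phase_time + s * e) + (phase_time + s * e)) * (1 / 4)"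
    using u_pos phase_time_pos s_pos e(2) by (subst (asm) ennreal_inj) auto
  then have "e * (2 - s) = u * (2 + 3 * s)"
    by (simp add: phase_time_def algebra_simps)
  then have "e = u * (2 + 3 * s) / (2 - s)"
    using s_less_1 by (simp add: eq_divide_eq)
  then show ?thesis using e(1) by simp
qed

end

section \<open>Back to radius \<open>\<rho>\<close>: arbitrary instances and their suprema\<close>

definition disk :: "real \<Rightarrow> algorithm" where
  "disk \<rho> \<omega> t = of_real \<rho> * half_angle.run (sqrt (\<rho>\<^sup>2 - 1) / \<rho>) (1 / \<rho>) \<omega> (t / \<rho>)"

lemma half_angle_disk:
  assumes "1 < \<rho>"
  shows "half_angle (sqrt (\<rho>\<^sup>2 - 1) / \<rho>) (1 / \<rho>)"
proof
  have "1 < \<rho>\<^sup>2" using assms by simp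
  then show "0 < sqrt (\<rho>\<^sup>2 - 1) / \<rho>" "(sqrt (\<rho>\<^sup>2 - 1) / \<rho>)\<^sup>2 + (1 / \<rho>)\<^sup>2 = 1"
    using assms by (simp_all add: power_divide field_simps)
qed (use assms in simp)

lemma online_algorithm_disk:
  assumes "1 < \<rho>"
  shows "online_algorithm \<rho> (disk \<rho>)"
proof -
  interpret half_angle "sqrt (\<rho>\<^sup>2 - 1) / \<rho>" "1 / \<rho>" by (rule half_angle_disk[OF assms])
  have "1-lipschitz_on {0..} (disk \<rho> \<omega>)" for \<omega>
  proof (rule lipschitz_onI)
    fix x y :: real assume "x \<in> {0..}" "y \<in> {0..}"
    then have "dist (run \<omega> (x / \<rho>)) (run \<omega> (y / \<rho>)) \<le> 1 * dist (x / \<rho>) (y / \<rho>)"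
      using assms by (intro lipschitz_onD[OF run_lipschitz]) auto
    also have "\<dots> = dist x y / \<rho>"
      using assms by (simp add: dist_real_def diff_divide_distrib[symmetric] abs_divide)
    finally show "dist (disk \<rho> \<omega> x) (disk \<rho> \<omega> y) \<le> 1 * dist x y"
      using assms by (simp add: disk_def dist_mult_left le_divide_eq mult.commute)
  qed simp
  moreover have "disk \<rho> \<omega> 0 = of_real \<rho>" for \<omega>
    by (simp add: disk_def run_at_0)
  moreover have "(\<lambda>\<omega>. disk \<rho> \<omega> t) \<in> borel_measurable coins" if "0 \<le> t" for t
    using run_measurable[of "t / \<rho>"] that assms unfolding disk_def by simp
  ultimately show ?thesis
    by (simp add: online_algorithm_def trajectory_def)
qed

text \<open>Supplies the rotation that makes the chord between the robots perpendicular to the real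
  axis: its factor \<open>\<kappa>\<close> satisfies
  \<open>e + e' = 2 * s * \<kappa>\<close>.\<close>

lemma unit_vectors_half_angle:
  fixes e e' :: complex
  assumes "norm e = 1" "norm e' = 1" "norm (e - e') = 2 * u" "s\<^sup>2 + u\<^sup>2 = 1"
  obtains \<kappa> y where "norm \<kappa> = 1" "y\<^sup>2 = u\<^sup>2" "e = \<kappa> * cnj (Complex s y)" "e' = \<kappa> * Complex s y"
proof -
  \<comment> \<open>The rotation from \<open>e\<close> to \<open>e'\<close>. Double-angle formulas
    give its real part and, up to sign, its imaginary part; \<open>v\<close> below is a square root
    of it, and \<open>\<kappa>\<close> is \<open>e * v\<close>.\<close>
  define r where "r = e' * cnj e"
  have ee: "e * cnj e = 1" using assms(1) by (simp add: complex_norm_square[symmetric])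
  have r: "norm r = 1" using assms(1,2) by (simp add: r_def norm_mult)
  have "norm (1 - r) = norm ((e - e') * cnj e)"
    using ee by (simp add: r_def left_diff_distrib)
  then have "(norm (1 - r))\<^sup>2 = 4 * u\<^sup>2"
    using assms(1,3) by (simp add: norm_mult power_mult_distrib)
  then have 1: "(1 - Re r)\<^sup>2 + (Im r)\<^sup>2 = 4 * u\<^sup>2" by (simp add: cmod_power2)
  have 2: "(Re r)\<^sup>2 + (Im r)\<^sup>2 = 1" using r by (metis cmod_power2 one_power2)
  have Re: "Re r = s\<^sup>2 - u\<^sup>2" using 1 2 assms(4) by (simp add: power2_eq_square algebra_simps)
  have "(s\<^sup>2 - u\<^sup>2)\<^sup>2 + (2 * s * u)\<^sup>2 = (s\<^sup>2 + u\<^sup>2)\<^sup>2" by (simp add: power2_eq_square algebra_simps)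
  then have "(Im r)\<^sup>2 = (2 * s * u)\<^sup>2" using 2 assms(4) by (simp add: Re)
  then have "Im r = 2 * s * u \<or> Im r = 2 * s * (- u)" by (auto simp: power2_eq_iff)
  then obtain y where y: "y\<^sup>2 = u\<^sup>2" "Im r = 2 * s * y"
    using power2_minus by blast
  define v where "v = Complex s y"
  have vv: "v * cnj v = 1" using assms(4) y(1) by (simp add: v_def complex_eq_iff power2_eq_square)
  have "r = v * v" using Re y by (simp add: v_def complex_eq_iff power2_eq_square)
  have "(norm v)\<^sup>2 = 1" using vv by (metis complex_norm_square of_real_eq_1_iff)
  then have "norm v = 1" by (simp add: abs_square_eq_1)
  show ?thesis
  proof (rule that[of "e * v" y])
    show "norm (e * v) = 1" using assms(1) \<open>norm v = 1\<close> by (simp add: norm_mult)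
    show "e = e * v * cnj (Complex s y)" using vv by (simp add: v_def mult.assoc)
    have "e' = r * e" using ee by (simp add: r_def mult.assoc mult.commute[of "cnj e"])
    then show "e' = e * v * Complex s y"
      using \<open>r = v * v\<close> by (simp add: v_def mult_ac)
  qed (rule y(1))
qed

text \<open>Every instance reduces to \<open>meeting_time\<close> after removal of a common
  similarity, so all have the same expected time.\<close>

lemma expected_time_disk:
  assumes "1 < \<rho>" and "(p, q, \<phi>, \<psi>) \<in> SRD \<rho>"
  shows "expected_time (disk \<rho>) \<phi> \<psi> =
    ennreal ((7 * \<rho>\<^sup>2 + 8 * \<rho> * sqrt (\<rho>\<^sup>2 - 1) - 3) / (3 * \<rho>\<^sup>2 + 1))"
proof -
  define s where "s = sqrt (\<rho>\<^sup>2 - 1) / \<rho>"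
  define u where "u = 1 / \<rho>"
  interpret half_angle s u unfolding s_def u_def by (rule half_angle_disk[OF assms(1)])
  obtain c where c: "dist p c = \<rho>" "dist q c = \<rho>" "dist p q = 2"
    "frame \<rho> c p \<phi>" "frame \<rho> c q \<psi>"
    using assms(2) by (auto simp: SRD_def)
  have "0 < \<rho>" using assms(1) by simp
  define e where "e = (p - c) / of_real \<rho>"
  define e' where "e' = (q - c) / of_real \<rho>"
  obtain \<sigma> where \<sigma>: "\<And>z. \<phi> z = c + e * mirror \<sigma> z" "norm e = 1"
    using frame_cases[OF c(4) \<open>0 < \<rho>\<close>] unfolding e_def by metis
  obtain \<sigma>' where \<sigma>': "\<And>z. \<psi> z = c + e' * mirror \<sigma>' z" "norm e' = 1"
    using frame_cases[OF c(5) \<open>0 < \<rho>\<close>] unfolding e'_def by metis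
  have "e - e' = (p - q) / of_real \<rho>" by (simp add: e_def e'_def diff_divide_distrib)
  then have "norm (e - e') = 2 * u"
    using c(3) \<open>0 < \<rho>\<close> by (simp add: u_def norm_divide dist_norm)
  then obtain \<kappa> y where \<kappa>: "norm \<kappa> = 1" and y: "y\<^sup>2 = u\<^sup>2"
    and e: "e = \<kappa> * cnj (Complex s y)" "e' = \<kappa> * Complex s y"
    using unit_vectors_half_angle[OF \<sigma>(2) \<sigma>'(2) _ pythagoras] by metis
  define v where "v = Complex s y"
  have "\<kappa> \<noteq> 0" using \<kappa> by auto
  have "rendezvous_time (\<lambda>t. \<phi> (disk \<rho> \<omega> t)) (\<lambda>t. \<psi> (disk \<rho> \<omega>' t)) =
      ennreal 0 + ennreal \<rho> * meeting_time v \<sigma> \<sigma>' (\<omega>, \<omega>')" for \<omega> \<omega>'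
    unfolding meeting_time_def prod.case
  proof (rule rendezvous_time_affine)
    fix t :: real
    have "\<phi> (disk \<rho> \<omega> (0 + \<rho> * t)) = c + (\<kappa> * of_real \<rho>) * (cnj v * mirror \<sigma> (run \<omega> t))"
      "\<psi> (disk \<rho> \<omega>' (0 + \<rho> * t)) = c + (\<kappa> * of_real \<rho>) * (v * mirror \<sigma>' (run \<omega>' t))"
      using \<open>0 < \<rho>\<close> by (simp_all add: \<sigma>(1) \<sigma>'(1) e v_def disk_def s_def[symmetric] u_def[symmetric] mult_ac)
    then show "\<phi> (disk \<rho> \<omega> (0 + \<rho> * t)) = \<psi> (disk \<rho> \<omega>' (0 + \<rho> * t)) \<longleftrightarrow>
        cnj v * mirror \<sigma> (run \<omega> t) = v * mirror \<sigma>' (run \<omega>' t)"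
      using \<open>\<kappa> \<noteq> 0\<close> \<open>0 < \<rho>\<close> by (simp only: add_left_cancel mult_cancel_left) simp
  qed (use \<open>0 < \<rho>\<close> in auto)
  then have "expected_time (disk \<rho>) \<phi> \<psi> =
      (\<integral>\<^sup>+p. ennreal \<rho> * meeting_time v \<sigma> \<sigma>' p \<partial>(coins \<Otimes>\<^sub>M coins))"
    unfolding expected_time_def case_prod_beta by simp
  also have "\<dots> = ennreal \<rho> * ennreal (u * (2 + 3 * s) / (2 - s))"
    by (simp only: nn_integral_cmult[OF meeting_time_measurable] expected_meeting_time[OF v_def y])
  also have "\<dots> = ennreal ((2 + 3 * s) / (2 - s))"
    using \<open>0 < \<rho>\<close> s_pos s_less_1 by (simp add: ennreal_mult'[symmetric] u_def)
  \<comment> \<open>The factor \<open>2 + s\<close> leaves only \<open>s\<^sup>2\<close> in the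
    denominator, and \<open>\<rho>\<^sup>2\<close> then clears the fractions.\<close>
  also have "(2 + 3 * s) / (2 - s) = ((2 + 3 * s) * (2 + s)) / ((2 - s) * (2 + s))"
    using s_pos by simp
  also have "\<dots> = (\<rho>\<^sup>2 * ((2 + 3 * s) * (2 + s))) / (\<rho>\<^sup>2 * ((2 - s) * (2 + s)))"
    using \<open>0 < \<rho>\<close> by simp
  also have "\<rho>\<^sup>2 * ((2 - s) * (2 + s)) = 3 * \<rho>\<^sup>2 + 1"
  proof -
    have "\<rho>\<^sup>2 * s\<^sup>2 = \<rho>\<^sup>2 - 1" using assms(1) by (simp add: s_def power_divide)
    then show ?thesis by (simp add: power2_eq_square algebra_simps)
  qed
  also have "\<rho>\<^sup>2 * ((2 + 3 * s) * (2 + s)) = 7 * \<rho>\<^sup>2 + 8 * \<rho> * sqrt (\<rho>\<^sup>2 - 1) - 3"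
  proof -
    have 1: "\<rho> * s = sqrt (\<rho>\<^sup>2 - 1)" using assms(1) by (simp add: s_def)
    have "\<rho>\<^sup>2 * s\<^sup>2 = \<rho>\<^sup>2 - 1" using assms(1) by (simp add: s_def power_divide)
    then show ?thesis unfolding 1[symmetric] by (simp add: power2_eq_square algebra_simps)
  qed
  finally show ?thesis .
qed

text \<open>A supremum over no instances would be \<open>0\<close>. The witness is centred at
  \<open>0\<close>, with the robots in the directions of the two headings.\<close>

lemma SRD_nonempty:
  assumes "1 < \<rho>"
  shows "SRD \<rho> \<noteq> {}"
proof -
  interpret half_angle "sqrt (\<rho>\<^sup>2 - 1) / \<rho>" "1 / \<rho>" by (rule half_angle_disk[OF assms])
  have "frame \<rho> 0 (of_real \<rho> * heading b) (\<lambda>z. heading b * z)" for b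
    using norm_heading by (simp add: frame_def dist_mult_left)
  moreover have "dist (of_real \<rho> * heading b) 0 = \<rho>" for b
    using assms norm_heading by (simp add: norm_mult)
  moreover have "dist (heading True) (heading False) = 2 / \<rho>"
    using assms by (simp add: heading_def dist_norm cmod_def)
  then have "dist (of_real \<rho> * heading True) (of_real \<rho> * heading False) = 2"
    using assms by (simp add: dist_mult_left)
  ultimately have "(of_real \<rho> * heading True, of_real \<rho> * heading False,
      \<lambda>z. heading True * z, \<lambda>z. heading False * z) \<in> SRD \<rho>"
    unfolding SRD_def by blast
  then show ?thesis by blast
qed

lemma expected_rendezvous_time_disk:
  assumes "1 < \<rho>"
  shows "expected_rendezvous_time \<rho> (disk \<rho>) =
    ennreal ((7 * \<rho>\<^sup>2 + 8 * \<rho> * sqrt (\<rho>\<^sup>2 - 1) - 3) / (3 * \<rho>\<^sup>2 + 1))" (is "_ = ?V")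
proof -
  have "expected_rendezvous_time \<rho> (disk \<rho>) = (SUP _\<in>SRD \<rho>. ?V)"
    unfolding expected_rendezvous_time_def
    by (intro SUP_cong) (auto simp: expected_time_disk[OF assms])
  then show ?thesis using SRD_nonempty[OF assms] by simp
qed

lemma competitive_ratio_disk:
  assumes "1 < \<rho>"
  shows "competitive_ratio \<rho> (disk \<rho>) = expected_rendezvous_time \<rho> (disk \<rho>)"
  unfolding competitive_ratio_def expected_rendezvous_time_def
  by (intro SUP_cong) (auto simp: SRD_def offline_opt_eq divide_ennreal_def)

section \<open>The effectiveness threshold\<close>

lemma ratio_le_iff:
  assumes "1 < \<rho>"
  shows "(7 * \<rho>\<^sup>2 + 8 * \<rho> * sqrt (\<rho>\<^sup>2 - 1) - 3) / (3 * \<rho>\<^sup>2 + 1) \<le> 4.25 \<longleftrightarrow> \<rho> \<le> 29 / sqrt 165"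
proof -
  define x where "x = sqrt (\<rho>\<^sup>2 - 1)"
  have "1 < \<rho>\<^sup>2" using assms by simp
  then have x: "0 < x" "x\<^sup>2 = \<rho>\<^sup>2 - 1" by (simp_all add: x_def)
  have "0 < 3 * \<rho>\<^sup>2 + 1" by (simp add: add_nonneg_pos)
  then have "(7 * \<rho>\<^sup>2 + 8 * \<rho> * x - 3) / (3 * \<rho>\<^sup>2 + 1) \<le> 4.25 \<longleftrightarrow> 32 * \<rho> * x \<le> 23 * \<rho>\<^sup>2 + 29"
    by (simp add: divide_le_eq) linarith
  \<comment> \<open>Writing the constant \<open>29\<close> as
    \<open>29 * (\<rho>\<^sup>2 - x\<^sup>2)\<close> gives a quadratic form that factors; the second
    factor is positive.\<close>
  also have "\<dots> \<longleftrightarrow> 0 \<le> (26 * \<rho> - 29 * x) * (2 * \<rho> + x)"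
  proof -
    have "(26 * \<rho> - 29 * x) * (2 * \<rho> + x) = 52 * \<rho>\<^sup>2 - 32 * \<rho> * x - 29 * x\<^sup>2"
      by (simp add: power2_eq_square algebra_simps)
    also have "\<dots> = 23 * \<rho>\<^sup>2 + 29 - 32 * \<rho> * x"
      unfolding x(2) by simp
    finally show ?thesis by simp
  qed
  also have "\<dots> \<longleftrightarrow> 29 * x \<le> 26 * \<rho>"
    using x(1) assms by (simp add: zero_le_mult_iff)
  also have "\<dots> \<longleftrightarrow> (29 * x)\<^sup>2 \<le> (26 * \<rho>)\<^sup>2"
    using x(1) assms by (intro power_mono_iff[symmetric]) simp_all
  \<comment> \<open>Here \<open>165 = 29\<^sup>2 - 26\<^sup>2\<close>.\<close>
  also have "\<dots> \<longleftrightarrow> \<rho>\<^sup>2 * 165 \<le> 29\<^sup>2"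
    by (simp add: power_mult_distrib x(2)) linarith
  also have "\<dots> \<longleftrightarrow> (\<rho> * sqrt 165)\<^sup>2 \<le> 29\<^sup>2"
    by (simp add: power_mult_distrib)
  also have "\<dots> \<longleftrightarrow> \<rho> * sqrt 165 \<le> 29"
    using assms by (subst power_mono_iff) auto
  finally show ?thesis unfolding x_def by (simp add: le_divide_eq)
qed

theorem theorem2:
  "\<exists>\<A> :: real \<Rightarrow> algorithm.
     (\<forall>\<rho> > sqrt 2. online_algorithm \<rho> (\<A> \<rho>) \<and>
        competitive_ratio \<rho> (\<A> \<rho>) =
          ennreal ((7 * \<rho>\<^sup>2 + 8 * \<rho> * sqrt (\<rho>\<^sup>2 - 1) - 3) / (3 * \<rho>\<^sup>2 + 1))) \<and>
     effective (29 / sqrt 165) \<A> \<and>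
     \<bar>29 / sqrt 165 - 2.25765\<bar> < (5 / 10 ^ 6 :: real)"
proof (intro exI[of _ disk] conjI allI impI)
  have "1 < sqrt 2" by simp
  then have big: "1 < \<rho>" if "sqrt 2 < \<rho>" for \<rho> using that by linarith
  show "online_algorithm \<rho> (disk \<rho>)" if "sqrt 2 < \<rho>" for \<rho>
    using online_algorithm_disk big[OF that] .
  show "competitive_ratio \<rho> (disk \<rho>) =
      ennreal ((7 * \<rho>\<^sup>2 + 8 * \<rho> * sqrt (\<rho>\<^sup>2 - 1) - 3) / (3 * \<rho>\<^sup>2 + 1))" if "sqrt 2 < \<rho>" for \<rho>
    by (simp only: competitive_ratio_disk[OF big[OF that]] expected_rendezvous_time_disk[OF big[OF that]])
  have "expected_rendezvous_time \<rho> (disk \<rho>) \<le> ennreal 4.25 \<longleftrightarrow> \<rho> \<le> 29 / sqrt 165" if "sqrt 2 < \<rho>" for \<rho>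
    unfolding expected_rendezvous_time_disk[OF big[OF that]] ratio_le_iff[OF big[OF that], symmetric]
    by (rule ennreal_le_iff) simp
  then have "{\<rho>. sqrt 2 < \<rho> \<and> expected_rendezvous_time \<rho> (disk \<rho>) \<le> ennreal 4.25} =
      {\<rho>. sqrt 2 < \<rho> \<and> \<rho> \<le> 29 / sqrt 165}"
    by blast
  \<comment> \<open>The threshold must itself be an admissible radius, which amounts to
    \<open>330 < 29\<^sup>2\<close>.\<close>
  moreover have "sqrt 2 < 29 / sqrt 165"
    by (simp add: less_divide_eq real_sqrt_mult[symmetric] real_less_lsqrt)
  ultimately show "effective (29 / sqrt 165) disk"
    by (simp add: effective_def)
  \<comment> \<open>The tolerance is half a unit in the fifth decimal; this bracket for
    \<open>sqrt 165\<close> is narrow enough for it.\<close>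
  have "12.845230 < sqrt 165" "sqrt 165 < 12.845233"
    by (rule real_less_rsqrt, simp add: power2_eq_square) (rule real_less_lsqrt, simp_all add: power2_eq_square)
  then have "29 / sqrt 165 < 29 / 12.845230" "29 / 12.845233 < 29 / sqrt 165"
    by (intro divide_strict_left_mono; simp)+
  then show "\<bar>29 / sqrt 165 - 2.25765\<bar> < (5 / 10 ^ 6 :: real)"
    by simp
qed

end
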